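(* Let $a,b,c,d\in\mathbb{R}$ with $a<b$ and $c<d$, and let $f,g:[a,b]\times[c,d]\to\mathbb{R}$ satisfy the following: (1) For each fixed $y_0\in[c,d]$, the functions given by $x\mapsto f(x,y_0)$ and $x\mapsto g(x,y_0)$ are continuous on $[a,b]$ and differentiable on $(a,b)$. (2) For each fixed $x_0\in[a,b]$, the functions given by $y\mapsto f_x(x_0,y)$ and $y\mapsto g_x(x_0,y)$ are continuous on $[c,d]$ and differentiable on $(c,d)$. Then there exists $(x_0,y_0)\in(a,b)\times(c,d)$ such that $$\frac{f_{xy}(x_0,y_0)}{g_{xy}(x_0,y_0)}=\frac{f(b,d)-f(b,c)-f(a,d)+f(a,c)}{g(b,d)-g(b,c)-g(a,d)+g(a,c)}.$$
   Context: $f_x$ denotes the partial derivative of $f$ with respect to the first variable, and $f_{xy}$ denotes the partial derivative of $f_x$ with respect to the second variable; likewise for $g$.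
   Formalization: The quotient equation can fail when g_xy vanishes (f=x³y, g=(x³+x²)y on [-1,1]×[0,1]), so it is proved in cross-multiplied form, and as a quotient, with both denominators nonzero, when g_xy has no zero in (a,b)×(c,d). *)

theory Defs
  imports "HOL-Analysis.Analysis"
begin

text \<open>
  Functions on a rectangle \<open>{a..b} \<times> {c..d}\<close> are rendered as total functions on
  \<open>real \<times> real\<close>. Partial derivatives are taken within the corresponding side of the
  rectangle, so that they are one-sided at its end points and do not depend on the values
  outside the rectangle.
\<close>

definition partial1 :: "real set \<Rightarrow> (real \<times> real \<Rightarrow> real) \<Rightarrow> real \<times> real \<Rightarrow> real" where
  "partial1 S f = (\<lambda>(x, y). vector_derivative (\<lambda>t. f (t, y)) (at x within S))"

definition partial2 :: "real set \<Rightarrow> (real \<times> real \<Rightarrow> real) \<Rightarrow> real \<times> real \<Rightarrow> real" where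
  "partial2 T f = (\<lambda>(x, y). vector_derivative (\<lambda>t. f (x, t)) (at y within T))"

text \<open>The second-order derivative \<open>f\<^sub>x\<^sub>y\<close>: first in \<open>x\<close>, then in \<open>y\<close>.\<close>

definition partial12 :: "real set \<Rightarrow> real set \<Rightarrow> (real \<times> real \<Rightarrow> real) \<Rightarrow> real \<times> real \<Rightarrow> real" where
  "partial12 S T f = partial2 T (partial1 S f)"

end

theory Submission
  imports Defs
begin

text \<open>
  Write \<open>\<Delta>F = F(b,d) - F(b,c) - F(a,d) + F(a,c)\<close>. If \<open>\<Delta>F = 0\<close>, the function
  \<open>x \<mapsto> F(x,d) - F(x,c)\<close> takes equal values at \<open>a\<close> and \<open>b\<close>, so Rolle's theorem gives \<open>x\<^sub>0\<close> with
  \<open>F\<^sub>x(x\<^sub>0,d) = F\<^sub>x(x\<^sub>0,c)\<close>, and Rolle's theorem for \<open>y \<mapsto> F\<^sub>x(x\<^sub>0,y)\<close> gives a zero of \<open>F\<^sub>x\<^sub>y\<close>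
  (lemma \<open>mixed_Rolle\<close>).

  As in the proof of Cauchy's mean value theorem, this is applied to the combination
  \<open>F = \<Delta>g f - \<Delta>f g\<close>, for which \<open>\<Delta>F = 0\<close> because \<open>\<Delta>\<close> is linear; a zero of \<open>F\<^sub>x\<^sub>y\<close> is the
  required point in cross-multiplied form. The quotient form needs \<open>\<Delta>g \<noteq> 0\<close> when \<open>g\<^sub>x\<^sub>y\<close> has no
  zero, which is the contrapositive of \<open>mixed_Rolle\<close> for \<open>F = g\<close>.
\<close>

lemma mixed_Rolle:
  fixes F D H :: "real \<Rightarrow> real \<Rightarrow> real"
  assumes "a < b" and "c < d"
    and contF: "\<And>y. y \<in> {c, d} \<Longrightarrow> continuous_on {a..b} (\<lambda>x. F x y)"
    and derF: "\<And>x y. x \<in> {a<..<b} \<Longrightarrow> y \<in> {c, d} \<Longrightarrow>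
                 ((\<lambda>x. F x y) has_real_derivative D x y) (at x)"
    and contD: "\<And>x. x \<in> {a<..<b} \<Longrightarrow> continuous_on {c..d} (D x)"
    and derD: "\<And>x y. x \<in> {a<..<b} \<Longrightarrow> y \<in> {c<..<d} \<Longrightarrow>
                 (D x has_real_derivative H x y) (at y)"
    and zero: "F b d - F b c - F a d + F a c = 0"
  shows "\<exists>x\<in>{a<..<b}. \<exists>y\<in>{c<..<d}. H x y = 0"
proof -
  have "\<exists>x. a < x \<and> x < b \<and> (*) (D x d - D x c) = (\<lambda>h. 0)"
  proof (rule Rolle_deriv[OF \<open>a < b\<close>, where f = "\<lambda>x. F x d - F x c"])
    show "F a d - F a c = F b d - F b c"
      using zero by simp
    show "continuous_on {a..b} (\<lambda>x. F x d - F x c)"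
      by (intro continuous_on_diff contF) auto
    show "((\<lambda>x. F x d - F x c) has_derivative (*) (D x d - D x c)) (at x)"
      if "a < x" "x < b" for x
    proof -
      have "((\<lambda>x. F x d - F x c) has_real_derivative D x d - D x c) (at x)"
        using that by (intro DERIV_diff derF) auto
      then show ?thesis
        by (simp add: has_field_derivative_def)
    qed
  qed
  then obtain x where x: "x \<in> {a<..<b}" and "(*) (D x d - D x c) = (\<lambda>h. 0)"
    by auto
  then have eq: "D x c = D x d"
    by (metis eq_iff_diff_eq_0 mult.right_neutral)
  have "\<exists>y. c < y \<and> y < d \<and> (*) (H x y) = (\<lambda>h. 0)"
  proof (rule Rolle_deriv[OF \<open>c < d\<close> eq contD[OF x]])
    show "(D x has_derivative (*) (H x y)) (at y)" if "c < y" "y < d" for y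
      using derD[OF x, of y] that
      by (simp add: has_field_derivative_def)
  qed
  then obtain y where "y \<in> {c<..<d}" "(*) (H x y) = (\<lambda>h. 0)"
    by auto
  then show ?thesis
    using x by (metis mult.right_neutral)
qed

text \<open>
  At an interior point the derivative within the closed interval is the two-sided derivative;
  this links \<^const>\<open>partial1\<close> and \<^const>\<open>partial12\<close> to Rolle's theorem.
\<close>

lemma has_real_derivative_within_Icc:
  fixes h :: "real \<Rightarrow> real"
  assumes "h differentiable_on {a<..<b}" and "x \<in> {a<..<b}"
  shows "(h has_real_derivative vector_derivative h (at x within {a..b})) (at x)"
proof -
  have "h differentiable (at x)"
    using assms by (simp add: differentiable_on_eq_differentiable_at)
  then show ?thesis
    using assms(2) at_within_Icc_at[of a x b]
    by (simp add: has_real_derivative_iff_has_vector_derivative flip: vector_derivative_works)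
qed

lemma has_real_derivative_partial1:
  assumes "(\<lambda>x. f (x, y)) differentiable_on {a<..<b}" and "x \<in> {a<..<b}"
  shows "((\<lambda>x. f (x, y)) has_real_derivative partial1 {a..b} f (x, y)) (at x)"
  using has_real_derivative_within_Icc[OF assms] by (simp add: partial1_def)

lemma has_real_derivative_partial12:
  assumes "(\<lambda>y. partial1 S f (x, y)) differentiable_on {c<..<d}" and "y \<in> {c<..<d}"
  shows "((\<lambda>y. partial1 S f (x, y)) has_real_derivative partial12 S {c..d} f (x, y)) (at y)"
  using has_real_derivative_within_Icc[OF assms] by (simp add: partial12_def partial2_def)

theorem theorem5:
  fixes a b c d :: real and f g :: "real \<times> real \<Rightarrow> real"
  assumes "a < b" and "c < d"
    and "\<And>y0. y0 \<in> {c..d} \<Longrightarrow>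
           continuous_on {a..b} (\<lambda>x. f (x, y0)) \<and> (\<lambda>x. f (x, y0)) differentiable_on {a<..<b}"
    and "\<And>y0. y0 \<in> {c..d} \<Longrightarrow>
           continuous_on {a..b} (\<lambda>x. g (x, y0)) \<and> (\<lambda>x. g (x, y0)) differentiable_on {a<..<b}"
    and "\<And>x0. x0 \<in> {a..b} \<Longrightarrow>
           continuous_on {c..d} (\<lambda>y. partial1 {a..b} f (x0, y)) \<and>
           (\<lambda>y. partial1 {a..b} f (x0, y)) differentiable_on {c<..<d}"
    and "\<And>x0. x0 \<in> {a..b} \<Longrightarrow>
           continuous_on {c..d} (\<lambda>y. partial1 {a..b} g (x0, y)) \<and>
           (\<lambda>y. partial1 {a..b} g (x0, y)) differentiable_on {c<..<d}"
  shows "\<exists>(x0, y0) \<in> {a<..<b} \<times> {c<..<d}.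
           partial12 {a..b} {c..d} f (x0, y0) * (g (b, d) - g (b, c) - g (a, d) + g (a, c)) =
           (f (b, d) - f (b, c) - f (a, d) + f (a, c)) * partial12 {a..b} {c..d} g (x0, y0) \<and>
           ((\<forall>(x, y) \<in> {a<..<b} \<times> {c<..<d}. partial12 {a..b} {c..d} g (x, y) \<noteq> 0) \<longrightarrow>
             partial12 {a..b} {c..d} g (x0, y0) \<noteq> 0 \<and>
             g (b, d) - g (b, c) - g (a, d) + g (a, c) \<noteq> 0 \<and>
             partial12 {a..b} {c..d} f (x0, y0) / partial12 {a..b} {c..d} g (x0, y0) =
             (f (b, d) - f (b, c) - f (a, d) + f (a, c)) /
             (g (b, d) - g (b, c) - g (a, d) + g (a, c)))"
proof -
  define \<Delta>f where "\<Delta>f = f (b, d) - f (b, c) - f (a, d) + f (a, c)"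
  define \<Delta>g where "\<Delta>g = g (b, d) - g (b, c) - g (a, d) + g (a, c)"
  let ?fx = "\<lambda>x y. partial1 {a..b} f (x, y)" and ?gx = "\<lambda>x y. partial1 {a..b} g (x, y)"
  let ?fxy = "\<lambda>x y. partial12 {a..b} {c..d} f (x, y)"
  let ?gxy = "\<lambda>x y. partial12 {a..b} {c..d} g (x, y)"
  have f1: "((\<lambda>x. f (x, y)) has_real_derivative ?fx x y) (at x)"
    and g1: "((\<lambda>x. g (x, y)) has_real_derivative ?gx x y) (at x)"
    if "x \<in> {a<..<b}" "y \<in> {c, d}" for x y
    using assms(2-4) that by (auto intro!: has_real_derivative_partial1)
  have f2: "(?fx x has_real_derivative ?fxy x y) (at y)"
    and g2: "(?gx x has_real_derivative ?gxy x y) (at y)"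
    if "x \<in> {a<..<b}" "y \<in> {c<..<d}" for x y
    using assms(5,6) that by (auto intro!: has_real_derivative_partial12)
  have "\<exists>x\<in>{a<..<b}. \<exists>y\<in>{c<..<d}. \<Delta>g * ?fxy x y - \<Delta>f * ?gxy x y = 0"
  proof (rule mixed_Rolle[OF assms(1,2),
        where F = "\<lambda>x y. \<Delta>g * f (x, y) - \<Delta>f * g (x, y)"
          and D = "\<lambda>x y. \<Delta>g * ?fx x y - \<Delta>f * ?gx x y"])
    show "continuous_on {a..b} (\<lambda>x. \<Delta>g * f (x, y) - \<Delta>f * g (x, y))" if "y \<in> {c, d}" for y
      using assms(2-4) that by (auto intro!: continuous_intros)
    show "continuous_on {c..d} (\<lambda>y. \<Delta>g * ?fx x y - \<Delta>f * ?gx x y)" if "x \<in> {a<..<b}" for x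
      using assms(5,6) that by (auto intro!: continuous_intros)
    show "\<Delta>g * f (b, d) - \<Delta>f * g (b, d) - (\<Delta>g * f (b, c) - \<Delta>f * g (b, c))
        - (\<Delta>g * f (a, d) - \<Delta>f * g (a, d)) + (\<Delta>g * f (a, c) - \<Delta>f * g (a, c)) = 0"
      unfolding \<Delta>f_def \<Delta>g_def by (simp add: algebra_simps)
  qed (intro DERIV_diff DERIV_cmult f1 g1 f2 g2; assumption)+
  then obtain x0 y0 where xy: "x0 \<in> {a<..<b}" "y0 \<in> {c<..<d}"
    and eq: "?fxy x0 y0 * \<Delta>g = \<Delta>f * ?gxy x0 y0"
    by (auto simp: mult.commute)
  have \<Delta>g_nonzero: "\<Delta>g \<noteq> 0" if "\<forall>(x, y) \<in> {a<..<b} \<times> {c<..<d}. ?gxy x y \<noteq> 0"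
  proof
    assume "\<Delta>g = 0"
    then have "\<exists>x\<in>{a<..<b}. \<exists>y\<in>{c<..<d}. ?gxy x y = 0"
      using assms(1,2,4,6)
      by (intro mixed_Rolle[where F = "\<lambda>x y. g (x, y)" and D = ?gx] g1 g2)
        (auto simp: \<Delta>g_def)
    with that show False
      by auto
  qed
  show ?thesis
    unfolding \<Delta>f_def[symmetric] \<Delta>g_def[symmetric]
  proof (intro bexI[of _ "(x0, y0)"], unfold prod.case, intro conjI impI)
    assume nz: "\<forall>(x, y) \<in> {a<..<b} \<times> {c<..<d}. ?gxy x y \<noteq> 0"
    show gxy: "?gxy x0 y0 \<noteq> 0"
      using nz xy by auto
    show "\<Delta>g \<noteq> 0"
      using nz by (rule \<Delta>g_nonzero)
    with gxy eq show "?fxy x0 y0 / ?gxy x0 y0 = \<Delta>f / \<Delta>g"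
      by (simp add: frac_eq_eq)
  qed (use xy eq in auto)
qed

end
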